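(* Let $X$ be a finite indecomposable q-cycle set such that $|X|>1$ and the permutation group $\mathcal{G}(X)$ acts regularly on $X$ (i.e. transitively with trivial point stabilizers). Then $X$ is retractable. Moreover, if $\mathcal{G}(X)$ is abelian, then $X$ is multipermutational.
   Context: A q-cycle set is a non-empty set $X$ with two binary operations $\cdot$ and $:$ such that for every $x\in X$ the map $\sigma_x:X\to X$, $y\mapsto x\cdot y$ is bijective, and for all $x,y,z\in X$: $(x\cdot y)\cdot(x\cdot z)=(y:x)\cdot(y\cdot z)$, $(x:y):(x:z)=(y\cdot x):(y:z)$, and $(x\cdot y):(x\cdot z)=(y:x)\cdot(y:z)$. It is regular if $\delta_x:X\to X$, $y\mapsto x:y$ is bijective for every $x\in X$. For a regular q-cycle set, the permutation group is $\mathcal{G}(X)=\langle\sigma_x,\delta_x\mid x\in X\rangle\le\mathrm{Sym}_X$, and $X$ is indecomposable if $X$ is regular and $\mathcal{G}(X)$ acts transitively on $X$. All q-cycle sets are finite. A regular q-cycle set $X$ is retractable if $|X|=1$ or there exist distinct $x,y\in X$ with $\sigma_x=\sigma_y$ and $\delta_x=\delta_y$. The retract relation on $X$ is $x\sim y\iff(\sigma_x=\sigma_y$ and $\delta_x=\delta_y)$; it is a congruence, and $\mathrm{Ret}(X):=X/{\sim}$ is a q-cycle set with the induced operations. Put $\mathrm{Ret}^0(X):=X$ and $\mathrm{Ret}^i(X):=\mathrm{Ret}(\mathrm{Ret}^{i-1}(X))$ for $i>0$. $X$ is multipermutational if $|\mathrm{Ret}^n(X)|=1$ for some non-negative integer $n$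 (the minimal such $n$ is its level). *)

theory Defs
  imports "HOL-Algebra.Group_Action" "HOL-Algebra.Elementary_Groups"
begin

section \<open>q-cycle sets\<close>

record 'a qcs = "'a partial_object" +
  dot   :: "'a \<Rightarrow> 'a \<Rightarrow> 'a" (infixl "\<cdot>\<index>" 70)
  colon :: "'a \<Rightarrow> 'a \<Rightarrow> 'a" (infixl "\<Colon>\<index>" 70)

locale q_cycle_set =
  fixes X :: "('a, 'b) qcs_scheme" (structure)
  assumes nonempty: "carrier X \<noteq> {}"
    and dot_bij: "x \<in> carrier X \<Longrightarrow> bij_betw (\<lambda>y. x \<cdot> y) (carrier X) (carrier X)"
    and colon_closed: "\<lbrakk>x \<in> carrier X; y \<in> carrier X\<rbrakk> \<Longrightarrow> x \<Colon> y \<in> carrier X"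
    and q1: "\<lbrakk>x \<in> carrier X; y \<in> carrier X; z \<in> carrier X\<rbrakk>
      \<Longrightarrow> (x \<cdot> y) \<cdot> (x \<cdot> z) = (y \<Colon> x) \<cdot> (y \<cdot> z)"
    and q2: "\<lbrakk>x \<in> carrier X; y \<in> carrier X; z \<in> carrier X\<rbrakk>
      \<Longrightarrow> (x \<Colon> y) \<Colon> (x \<Colon> z) = (y \<cdot> x) \<Colon> (y \<Colon> z)"
    and q3: "\<lbrakk>x \<in> carrier X; y \<in> carrier X; z \<in> carrier X\<rbrakk>
      \<Longrightarrow> (x \<cdot> y) \<Colon> (x \<cdot> z) = (y \<Colon> x) \<cdot> (y \<Colon> z)"

locale regular_q_cycle_set = q_cycle_set +
  assumes colon_bij: "x \<in> carrier X \<Longrightarrow> bij_betw (\<lambda>y. x \<Colon> y) (carrier X) (carrier X)"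

text \<open>Restricting to the carrier makes equality of these functions mean equality as
  maps on \<open>X\<close>, and puts them into \<^term>\<open>Bij (carrier X)\<close>.\<close>

definition sigma :: "('a, 'b) qcs_scheme \<Rightarrow> 'a \<Rightarrow> 'a \<Rightarrow> 'a"
  where "sigma X x = (\<lambda>y \<in> carrier X. x \<cdot>\<^bsub>X\<^esub> y)"

definition delta :: "('a, 'b) qcs_scheme \<Rightarrow> 'a \<Rightarrow> 'a \<Rightarrow> 'a"
  where "delta X x = (\<lambda>y \<in> carrier X. x \<Colon>\<^bsub>X\<^esub> y)"


section \<open>Permutation group and indecomposability\<close>

text \<open>\<^const>\<open>subgroup_generated\<close> intersects the generators with the carrier of the
  ambient group; for a regular \<open>X\<close> all of them lie in \<^term>\<open>Bij (carrier X)\<close>.\<close>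

definition perm_group :: "('a, 'b) qcs_scheme \<Rightarrow> ('a \<Rightarrow> 'a) monoid"
  where "perm_group X = subgroup_generated (BijGroup (carrier X))
           (sigma X ` carrier X \<union> delta X ` carrier X)"

definition indecomposable :: "('a, 'b) qcs_scheme \<Rightarrow> bool"
  where "indecomposable X \<longleftrightarrow>
           regular_q_cycle_set X \<and> transitive_action (perm_group X) (carrier X) (\<lambda>g. g)"

definition acts_regularly :: "('g, 'c) monoid_scheme \<Rightarrow> 'e set \<Rightarrow> ('g \<Rightarrow> 'e \<Rightarrow> 'e) \<Rightarrow> bool"
  where "acts_regularly G E \<phi> \<longleftrightarrow>
           transitive_action G E \<phi> \<and> (\<forall>x \<in> E. stabilizer G \<phi> x = {\<one>\<^bsub>G\<^esub>})"


section \<open>Retraction\<close>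

definition retractable :: "('a, 'b) qcs_scheme \<Rightarrow> bool"
  where "retractable X \<longleftrightarrow> card (carrier X) = 1 \<or>
           (\<exists>x \<in> carrier X. \<exists>y \<in> carrier X.
              x \<noteq> y \<and> sigma X x = sigma X y \<and> delta X x = delta X y)"

definition retract_rel :: "('a, 'b) qcs_scheme \<Rightarrow> ('a \<times> 'a) set"
  where "retract_rel X = {(x, y). x \<in> carrier X \<and> y \<in> carrier X \<and>
           sigma X x = sigma X y \<and> delta X x = delta X y}"

text \<open>The retract on the set of equivalence classes. As the relation is a congruence, the
  unions below are over copies of one and the same class.\<close>

definition retract :: "('a, 'b) qcs_scheme \<Rightarrow> 'a set qcs"
  where "retract X = \<lparr>carrier = carrier X // retract_rel X,
           dot   = (\<lambda>C D. \<Union>x \<in> C. \<Union>y \<in> D. retract_rel X `` {x \<cdot>\<^bsub>X\<^esub> y}),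
           colon = (\<lambda>C D. \<Union>x \<in> C. \<Union>y \<in> D. retract_rel X `` {x \<Colon>\<^bsub>X\<^esub> y})\<rparr>"

text \<open>Since \<^const>\<open>retract\<close> changes the type of the elements, it cannot be iterated as it
  stands. So the quotient is transported back to the original type, along the injection that
  chooses a representative of each class.\<close>

definition transport :: "('a \<Rightarrow> 'b) \<Rightarrow> ('a, 'c) qcs_scheme \<Rightarrow> 'b qcs"
  where "transport f Q = \<lparr>carrier = f ` carrier Q,
           dot   = (\<lambda>x y. f (inv_into (carrier Q) f x \<cdot>\<^bsub>Q\<^esub> inv_into (carrier Q) f y)),
           colon = (\<lambda>x y. f (inv_into (carrier Q) f x \<Colon>\<^bsub>Q\<^esub> inv_into (carrier Q) f y))\<rparr>"

definition class_rep :: "'a set \<Rightarrow> 'a"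
  where "class_rep C = (SOME x. x \<in> C)"

definition Ret :: "'a qcs \<Rightarrow> 'a qcs"
  where "Ret X = transport class_rep (retract X)"

definition multipermutational :: "'a qcs \<Rightarrow> bool"
  where "multipermutational X \<longleftrightarrow> (\<exists>n. card (carrier ((Ret ^^ n) X)) = 1)"


section \<open>Adequacy of the retraction\<close>

lemma equiv_retract_rel: "equiv (carrier X) (retract_rel X)"
  by (auto simp: equiv_def refl_on_def sym_def trans_def retract_rel_def)

lemma retract_rel_iff:
  "(x, y) \<in> retract_rel X \<longleftrightarrow> x \<in> carrier X \<and> y \<in> carrier X \<and>
     (\<forall>z \<in> carrier X. x \<cdot>\<^bsub>X\<^esub> z = y \<cdot>\<^bsub>X\<^esub> z \<and> x \<Colon>\<^bsub>X\<^esub> z = y \<Colon>\<^bsub>X\<^esub> z)"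
  by (auto simp: retract_rel_def sigma_def delta_def restrict_def fun_eq_iff)

lemma (in q_cycle_set) dot_closed:
  "\<lbrakk>x \<in> carrier X; y \<in> carrier X\<rbrakk> \<Longrightarrow> x \<cdot> y \<in> carrier X"
  using dot_bij bij_betwE by blast

lemma (in regular_q_cycle_set) retract_rel_congruence:
  assumes "(x, x') \<in> retract_rel X" "(y, y') \<in> retract_rel X"
  shows "(x \<cdot> y, x' \<cdot> y') \<in> retract_rel X" "(x \<Colon> y, x' \<Colon> y') \<in> retract_rel X"
proof -
  have c: "x \<in> carrier X" "x' \<in> carrier X" "y \<in> carrier X" "y' \<in> carrier X"
    and e: "\<And>z. z \<in> carrier X \<Longrightarrow> x \<cdot> z = x' \<cdot> z" "\<And>z. z \<in> carrier X \<Longrightarrow> x \<Colon> z = x' \<Colon> z"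
      "\<And>z. z \<in> carrier X \<Longrightarrow> y \<cdot> z = y' \<cdot> z" "\<And>z. z \<in> carrier X \<Longrightarrow> y \<Colon> z = y' \<Colon> z"
    using assms by (auto simp: retract_rel_iff)
  have "(x \<cdot> y) \<cdot> z = (x' \<cdot> y') \<cdot> z \<and> (x \<cdot> y) \<Colon> z = (x' \<cdot> y') \<Colon> z" if "z \<in> carrier X" for z
  proof -
    obtain w where w: "w \<in> carrier X" "z = x \<cdot> w"
      using \<open>z \<in> carrier X\<close> dot_bij[OF c(1)] by (auto simp: bij_betw_def)
    show ?thesis
      using q1[OF c(1,3) w(1)] q1[OF c(1,4) w(1)] q3[OF c(1,3) w(1)] q3[OF c(1,4) w(1)]
        w c e by simp
  qed
  moreover have "(x \<Colon> y) \<cdot> z = (x' \<Colon> y') \<cdot> z \<and> (x \<Colon> y) \<Colon> z = (x' \<Colon> y') \<Colon> z"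
    if "z \<in> carrier X" for z
  proof -
    obtain w where w: "w \<in> carrier X" "z = x \<Colon> w"
      using \<open>z \<in> carrier X\<close> colon_bij[OF c(1)] by (auto simp: bij_betw_def)
    show ?thesis
      using q3[OF c(3,1) w(1)] q3[OF c(4,1) w(1)] q2[OF c(1,3) w(1)] q2[OF c(1,4) w(1)]
        w c e by simp
  qed
  ultimately show "(x \<cdot> y, x' \<cdot> y') \<in> retract_rel X" "(x \<Colon> y, x' \<Colon> y') \<in> retract_rel X"
    using c by (auto simp: retract_rel_iff dot_closed colon_closed)
qed

lemma (in regular_q_cycle_set) retract_ops:
  assumes "x \<in> carrier X" "y \<in> carrier X"
  shows "retract_rel X `` {x} \<cdot>\<^bsub>retract X\<^esub> retract_rel X `` {y} = retract_rel X `` {x \<cdot> y}"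
    and "retract_rel X `` {x} \<Colon>\<^bsub>retract X\<^esub> retract_rel X `` {y} = retract_rel X `` {x \<Colon> y}"
proof -
  have "congruent2 (retract_rel X) (retract_rel X) (\<lambda>x y. retract_rel X `` {x \<cdot> y})"
    "congruent2 (retract_rel X) (retract_rel X) (\<lambda>x y. retract_rel X `` {x \<Colon> y})"
    by (auto simp: congruent2_def intro!: equiv_class_eq[OF equiv_retract_rel]
        retract_rel_congruence)
  from UN_equiv_class2[OF equiv_retract_rel equiv_retract_rel this(1) assms]
    UN_equiv_class2[OF equiv_retract_rel equiv_retract_rel this(2) assms]
  show "retract_rel X `` {x} \<cdot>\<^bsub>retract X\<^esub> retract_rel X `` {y} = retract_rel X `` {x \<cdot> y}"
    "retract_rel X `` {x} \<Colon>\<^bsub>retract X\<^esub> retract_rel X `` {y} = retract_rel X `` {x \<Colon> y}"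
    by (simp_all add: retract_def)
qed

lemma inj_on_class_rep: "inj_on class_rep (carrier (retract X))"
proof (rule inj_onI)
  fix C D assume C: "C \<in> carrier (retract X)" and D: "D \<in> carrier (retract X)"
    and eq: "class_rep C = class_rep D"
  have "class_rep C \<in> C" if "C \<in> carrier X // retract_rel X" for C
    using in_quotient_imp_non_empty[OF equiv_retract_rel that]
    by (auto simp: class_rep_def intro: someI)
  then have "class_rep C \<in> C \<inter> D"
    using C D eq by (metis IntI partial_object.select_convs(1) retract_def)
  then show "C = D"
    using C D quotient_disj[OF equiv_retract_rel] by (fastforce simp: retract_def)
qed

lemma retract_regular:
  assumes "regular_q_cycle_set X" and fin: "finite (carrier X)"
  shows "regular_q_cycle_set (retract X)"
proof -
  interpret regular_q_cycle_set X by fact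
  let ?c = "\<lambda>x. retract_rel X `` {x}"
  have car: "carrier (retract X) = ?c ` carrier X"
    by (auto simp: retract_def quotient_def)
  have bij: "bij_betw f (carrier (retract X)) (carrier (retract X))"
    if g: "bij_betw g (carrier X) (carrier X)"
      and f: "\<And>y. y \<in> carrier X \<Longrightarrow> f (?c y) = ?c (g y)" for f g
  proof -
    have "f ` carrier (retract X) = ?c ` g ` carrier X"
      unfolding car image_image using f by (intro image_cong) auto
    also have "\<dots> = carrier (retract X)"
      using g by (simp add: car bij_betw_def)
    finally show ?thesis
      using fin by (simp add: bij_betw_def eq_card_imp_inj_on car)
  qed
  show ?thesis
  proof
    show "carrier (retract X) \<noteq> {}" using nonempty by (simp add: car)
  next
    fix C assume "C \<in> carrier (retract X)"
    then obtain x where x: "x \<in> carrier X" "C = ?c x" by (auto simp: car)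
    show "bij_betw (\<lambda>D. C \<cdot>\<^bsub>retract X\<^esub> D) (carrier (retract X)) (carrier (retract X))"
      by (rule bij[OF dot_bij[OF x(1)]]) (simp add: x retract_ops)
    show "bij_betw (\<lambda>D. C \<Colon>\<^bsub>retract X\<^esub> D) (carrier (retract X)) (carrier (retract X))"
      by (rule bij[OF colon_bij[OF x(1)]]) (simp add: x retract_ops)
  qed (auto simp: car retract_ops dot_closed colon_closed q1 q2 q3)
qed

lemma transport_regular:
  assumes "regular_q_cycle_set Q" and inj: "inj_on f (carrier Q)"
  shows "regular_q_cycle_set (transport f Q)"
proof -
  interpret regular_q_cycle_set Q by fact
  have car: "carrier (transport f Q) = f ` carrier Q" by (simp add: transport_def)
  have ops: "f x \<cdot>\<^bsub>transport f Q\<^esub> f y = f (x \<cdot>\<^bsub>Q\<^esub> y)"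
    "f x \<Colon>\<^bsub>transport f Q\<^esub> f y = f (x \<Colon>\<^bsub>Q\<^esub> y)"
    if "x \<in> carrier Q" "y \<in> carrier Q" for x y
    using that inj by (simp_all add: transport_def)
  have bij: "bij_betw h (f ` carrier Q) (f ` carrier Q)"
    if g: "bij_betw g (carrier Q) (carrier Q)"
      and h: "\<And>y. y \<in> carrier Q \<Longrightarrow> h (f y) = f (g y)" for h g
  proof -
    have "bij_betw (\<lambda>y. f (g y)) (carrier Q) (f ` carrier Q)"
      using bij_betw_trans[OF g inj_on_imp_bij_betw[OF inj]] by (simp add: o_def)
    then have "bij_betw (\<lambda>y. h (f y)) (carrier Q) (f ` carrier Q)"
      using h by (simp cong: bij_betw_cong)
    then show ?thesis
      using bij_betw_comp_iff[OF inj_on_imp_bij_betw[OF inj], of h "f ` carrier Q"]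
      by (simp add: o_def)
  qed
  show ?thesis
  proof
    show "carrier (transport f Q) \<noteq> {}" using nonempty by (simp add: car)
  next
    fix C assume "C \<in> carrier (transport f Q)"
    then obtain x where x: "x \<in> carrier Q" "C = f x" by (auto simp: car)
    show "bij_betw (\<lambda>D. C \<cdot>\<^bsub>transport f Q\<^esub> D) (carrier (transport f Q)) (carrier (transport f Q))"
      unfolding car by (rule bij[OF dot_bij[OF x(1)]]) (simp add: x ops)
    show "bij_betw (\<lambda>D. C \<Colon>\<^bsub>transport f Q\<^esub> D) (carrier (transport f Q)) (carrier (transport f Q))"
      unfolding car by (rule bij[OF colon_bij[OF x(1)]]) (simp add: x ops)
  qed (auto simp: car ops dot_closed colon_closed q1 q2 q3)
qed

corollary Ret_regular:
  "\<lbrakk>regular_q_cycle_set X; finite (carrier X)\<rbrakk> \<Longrightarrow> regular_q_cycle_set (Ret X)"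
  unfolding Ret_def by (intro transport_regular retract_regular inj_on_class_rep)

lemma (in regular_q_cycle_set) perm_group_generators:
  "sigma X ` carrier X \<union> delta X ` carrier X \<subseteq> carrier (BijGroup (carrier X))"
  using dot_bij colon_bij
  by (auto simp: sigma_def delta_def BijGroup_def Bij_def cong: bij_betw_cong)

end

theory Submission
  imports Defs
begin

text \<open>
  Why the theorem holds. Put \<open>y = x\<close> in the first two defining identities: they say that
  \<open>x \<cdot> x\<close> and \<open>x \<Colon> x\<close> act in the same way, so in an irretractable \<open>X\<close> they coincide. Hence
  \<open>\<sigma>\<^sub>x\<close> and \<open>\<delta>\<^sub>x\<close> agree at the point \<open>x\<close>, and when the permutation group has trivial point
  stabilizers this forces \<open>\<sigma>\<^sub>x = \<delta>\<^sub>x\<close>. Irretractability now means that \<open>x \<mapsto> \<sigma>\<^sub>x\<close> is injective.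
  Trivial stabilizers then make \<open>x \<mapsto> \<sigma>\<^sub>x(z)\<close> injective for any point \<open>z\<close>, so by finiteness
  some \<open>\<sigma>\<^sub>x\<close> fixes \<open>z\<close> and is the identity. The first identity turns this into
  \<open>\<sigma>\<^bsub>y \<cdot> x\<^esub> = id = \<sigma>\<^sub>x\<close>, that is \<open>y \<cdot> x = x\<close>, for all \<open>y\<close>. So every \<open>\<sigma>\<^sub>y\<close> fixes \<open>x\<close> and is the
  identity, and by injectivity of \<open>\<sigma>\<close> there is only one point.

  Regularity of the action enters as the property that two of the maps
  \<open>\<sigma>\<^sub>x\<close>, \<open>\<delta>\<^sub>x\<close>, \<open>id\<close> which agree at one point are equal (\<open>translations_free\<close>, lemma
  \<open>retractable_if_translations_free\<close>).

  For the second claim, a transitive abelian group has trivial stabilizers, since the points at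
  which two commuting permutations agree form an invariant set. Both "the translations commute" and
  "there is no proper non-empty invariant set" pass to homomorphic images, in particular to
  the retract. So the first argument applies again to every iterated retract, and retraction
  decreases the cardinality until one point is left (\<open>multipermutational_if_commute\<close>).
\<close>

section \<open>Translations\<close>

definition translation_maps :: "('a, 'b) qcs_scheme \<Rightarrow> ('a \<Rightarrow> 'a) set"
  where "translation_maps X = sigma X ` carrier X \<union> delta X ` carrier X"

text \<open>The identity is included so that a translation with a fixed point is trivial.\<close>

definition translations_free :: "('a, 'b) qcs_scheme \<Rightarrow> bool"
  where "translations_free X \<longleftrightarrow>
    (\<forall>f \<in> insert (\<lambda>x \<in> carrier X. x) (translation_maps X).
     \<forall>g \<in> insert (\<lambda>x \<in> carrier X. x) (translation_maps X).
     \<forall>z \<in> carrier X. f z = g z \<longrightarrow> f = g)"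

definition translations_commute :: "('a, 'b) qcs_scheme \<Rightarrow> bool"
  where "translations_commute X \<longleftrightarrow>
    (\<forall>f \<in> translation_maps X. \<forall>g \<in> translation_maps X. \<forall>z \<in> carrier X. f (g z) = g (f z))"

text \<open>For finite \<open>X\<close> this is transitivity of the permutation group. The formulation by
  invariant sets avoids words in the generators, so that it passes to quotients by taking
  preimages.\<close>

definition no_invariant_subset :: "('a, 'b) qcs_scheme \<Rightarrow> bool"
  where "no_invariant_subset X \<longleftrightarrow>
    (\<forall>S \<subseteq> carrier X. S \<noteq> {} \<longrightarrow> (\<forall>f \<in> translation_maps X. f ` S \<subseteq> S) \<longrightarrow> S = carrier X)"

lemma sigma_in_translation_maps: "x \<in> carrier X \<Longrightarrow> sigma X x \<in> translation_maps X"
  and delta_in_translation_maps: "x \<in> carrier X \<Longrightarrow> delta X x \<in> translation_maps X"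
  by (auto simp: translation_maps_def)

lemma translations_extensional: "f \<in> translation_maps X \<Longrightarrow> f \<in> extensional (carrier X)"
  by (auto simp: translation_maps_def sigma_def delta_def)

lemma (in regular_q_cycle_set) translations_bij:
  "f \<in> translation_maps X \<Longrightarrow> bij_betw f (carrier X) (carrier X)"
  using perm_group_generators by (auto simp: translation_maps_def BijGroup_def Bij_def)


section \<open>Free translations force retractability\<close>

text \<open>These are the identities \<open>q1\<close> and \<open>q2\<close> with \<open>y = x\<close>; every point has the form \<open>x \<cdot> w\<close> and the
  form \<open>x \<Colon> w\<close>.\<close>

lemma (in regular_q_cycle_set) squares_related:
  assumes x: "x \<in> carrier X"
  shows "(x \<cdot> x, x \<Colon> x) \<in> retract_rel X"
proof -
  have "(x \<cdot> x) \<cdot> z = (x \<Colon> x) \<cdot> z" if z: "z \<in> carrier X" for z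
  proof -
    obtain w where "w \<in> carrier X" "z = x \<cdot> w"
      using z dot_bij[OF x] by (auto simp: bij_betw_def)
    then show ?thesis using q1[OF x x] by simp
  qed
  moreover have "(x \<cdot> x) \<Colon> z = (x \<Colon> x) \<Colon> z" if z: "z \<in> carrier X" for z
  proof -
    obtain w where "w \<in> carrier X" "z = x \<Colon> w"
      using z colon_bij[OF x] by (auto simp: bij_betw_def)
    then show ?thesis using q2[OF x x] by simp
  qed
  ultimately show ?thesis
    using x by (simp add: retract_rel_iff dot_closed colon_closed)
qed

lemma (in regular_q_cycle_set) retractable_if_translations_free:
  assumes fin: "finite (carrier X)" and free: "translations_free X"
  shows "retractable X"
proof (rule ccontr)
  assume irr: "\<not> retractable X"
  have inj: "x = y"
    if "x \<in> carrier X" "y \<in> carrier X" "sigma X x = sigma X y" "delta X x = delta X y" for x y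
    using irr that by (auto simp: retractable_def)
  have free_id: "f = (\<lambda>x \<in> carrier X. x)"
    if "f \<in> translation_maps X" "z \<in> carrier X" "f z = z" for f z
    using free[unfolded translations_free_def, rule_format, of f "\<lambda>x \<in> carrier X. x" z] that
    by simp
  have free_eq: "f = g"
    if "f \<in> translation_maps X" "g \<in> translation_maps X" "z \<in> carrier X" "f z = g z" for f g z
    using free[unfolded translations_free_def, rule_format, of f g z] that by simp
  have sd: "sigma X x = delta X x" if x: "x \<in> carrier X" for x
  proof (rule free_eq[OF sigma_in_translation_maps delta_in_translation_maps, OF x x x])
    have "x \<cdot> x = x \<Colon> x"
      using squares_related[OF x] by (auto simp: retract_rel_def intro: inj)
    then show "sigma X x x = delta X x x" using x by (simp add: sigma_def delta_def)
  qed
  then have sigma_inj: "x = y"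
    if "x \<in> carrier X" "y \<in> carrier X" "sigma X x = sigma X y" for x y
    using that inj by metis
  have dot_colon: "x \<Colon> y = x \<cdot> y" if "x \<in> carrier X" "y \<in> carrier X" for x y
    using fun_cong[OF sd, of x y] that by (simp add: sigma_def delta_def)
  obtain z where z: "z \<in> carrier X" using nonempty by blast
  have "inj_on (\<lambda>x. x \<cdot> z) (carrier X)"
  proof (rule inj_onI)
    fix x y assume x: "x \<in> carrier X" and y: "y \<in> carrier X" and "x \<cdot> z = y \<cdot> z"
    then have "sigma X x z = sigma X y z" using z by (simp add: sigma_def)
    then have "sigma X x = sigma X y"
      by (rule free_eq[OF sigma_in_translation_maps sigma_in_translation_maps, OF x y z])
    then show "x = y" by (rule sigma_inj[OF x y])
  qed
  moreover have "(\<lambda>x. x \<cdot> z) ` carrier X \<subseteq> carrier X" using z by (auto intro: dot_closed)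
  ultimately have "(\<lambda>x. x \<cdot> z) ` carrier X = carrier X"
    using fin by (intro endo_inj_surj)
  with z obtain x where x: "x \<in> carrier X" and "x \<cdot> z = z" by (metis imageE)
  then have "sigma X x = (\<lambda>x \<in> carrier X. x)"
    using z by (intro free_id[OF sigma_in_translation_maps z]) (simp_all add: sigma_def)
  then have x_id: "x \<cdot> w = w" if "w \<in> carrier X" for w
    using that by (metis restrict_apply' sigma_def)
  have sigma_id: "sigma X y = (\<lambda>x \<in> carrier X. x)" if y: "y \<in> carrier X" for y
  proof -
    \<comment> \<open>The identity \<open>q1\<close> for \<open>x\<close> and \<open>y\<close> now reads \<open>y \<cdot> w = (y \<cdot> x) \<cdot> (y \<cdot> w)\<close>.\<close>
    have "(y \<cdot> x) \<cdot> v = x \<cdot> v" if v: "v \<in> carrier X" for v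
    proof -
      obtain w where "w \<in> carrier X" "v = y \<cdot> w"
        using v dot_bij[OF y] by (auto simp: bij_betw_def)
      then show ?thesis
        using q1[OF x y, of w] x y v by (simp add: x_id dot_colon)
    qed
    then have "sigma X (y \<cdot> x) = sigma X x"
      unfolding sigma_def by (intro restrict_ext)
    then have "y \<cdot> x = x" by (rule sigma_inj[OF dot_closed[OF y x] x])
    then show ?thesis
      using x y by (intro free_id[OF sigma_in_translation_maps, of y x]) (auto simp: sigma_def)
  qed
  then have "y = x" if "y \<in> carrier X" for y
    using that x sigma_inj by metis
  then have "carrier X = {x}" using x by blast
  with irr show False by (simp add: retractable_def)
qed

text \<open>The points where two maps agree form a set that is invariant under every map commuting with
  both.\<close>

lemma (in regular_q_cycle_set) translations_free_if_commute:
  assumes comm: "translations_commute X" and min: "no_invariant_subset X"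
  shows "translations_free X"
  unfolding translations_free_def
proof (intro ballI impI)
  fix f g z
  let ?T = "insert (\<lambda>x \<in> carrier X. x) (translation_maps X)"
  assume f: "f \<in> ?T" and g: "g \<in> ?T" and z: "z \<in> carrier X" "f z = g z"
  let ?S = "{y \<in> carrier X. f y = g y}"
  have closed: "h y \<in> carrier X" if "h \<in> translation_maps X" "y \<in> carrier X" for h y
    using that translations_bij bij_betwE by blast
  have comm': "k (h y) = h (k y)" if "k \<in> ?T" "h \<in> translation_maps X" "y \<in> carrier X" for k h y
    using that comm closed by (auto simp: translations_commute_def)
  have "\<forall>h \<in> translation_maps X. h ` ?S \<subseteq> ?S"
    using f g by (auto simp: closed comm')
  then have "?S = carrier X"
    using min[unfolded no_invariant_subset_def, rule_format, of ?S] z by blast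
  moreover have "f \<in> extensional (carrier X)" "g \<in> extensional (carrier X)"
    using f g translations_extensional by auto
  ultimately show "f = g"
    by (intro extensionalityI[of f "carrier X" g]) auto
qed


section \<open>Passing to the retract\<close>

text \<open>A homomorphism \<open>p\<close> intertwines the translations, so commutation can be lifted, and
  invariant subsets have invariant preimages.\<close>

context
  fixes X :: "('a, 'b) qcs_scheme" and Y :: "('c, 'd) qcs_scheme" and p :: "'a \<Rightarrow> 'c"
  assumes surj: "p ` carrier X = carrier Y"
    and hom_dot: "\<And>x y. \<lbrakk>x \<in> carrier X; y \<in> carrier X\<rbrakk> \<Longrightarrow> p (x \<cdot>\<^bsub>X\<^esub> y) = p x \<cdot>\<^bsub>Y\<^esub> p y"
    and hom_colon: "\<And>x y. \<lbrakk>x \<in> carrier X; y \<in> carrier X\<rbrakk> \<Longrightarrow> p (x \<Colon>\<^bsub>X\<^esub> y) = p x \<Colon>\<^bsub>Y\<^esub> p y"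
    and X: "regular_q_cycle_set X"
begin

lemma translation_lift:
  assumes "g \<in> translation_maps Y"
  obtains f where "f \<in> translation_maps X" "\<And>z. z \<in> carrier X \<Longrightarrow> g (p z) = p (f z)"
proof -
  obtain y where y: "y \<in> carrier Y" "g = sigma Y y \<or> g = delta Y y"
    using assms by (auto simp: translation_maps_def)
  then obtain x where x: "x \<in> carrier X" "y = p x" using surj by blast
  have pz: "p z \<in> carrier Y" if "z \<in> carrier X" for z using that surj by blast
  from y(2) show thesis
  proof
    assume "g = sigma Y y"
    then show thesis
      using x pz by (intro that[OF sigma_in_translation_maps[OF x(1)]]) (simp add: sigma_def hom_dot)
  next
    assume "g = delta Y y"
    then show thesis
      using x pz by (intro that[OF delta_in_translation_maps[OF x(1)]]) (simp add: delta_def hom_colon)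
  qed
qed

lemma translation_in_carrier:
  "\<lbrakk>f \<in> translation_maps X; z \<in> carrier X\<rbrakk> \<Longrightarrow> f z \<in> carrier X"
  using regular_q_cycle_set.translations_bij[OF X] bij_betwE by blast

lemma translations_commute_image:
  assumes comm: "translations_commute X"
  shows "translations_commute Y"
  unfolding translations_commute_def
proof (intro ballI)
  fix f g y assume f: "f \<in> translation_maps Y" and g: "g \<in> translation_maps Y" and "y \<in> carrier Y"
  obtain f' where f': "f' \<in> translation_maps X" "\<And>z. z \<in> carrier X \<Longrightarrow> f (p z) = p (f' z)"
    using translation_lift[OF f] by blast
  obtain g' where g': "g' \<in> translation_maps X" "\<And>z. z \<in> carrier X \<Longrightarrow> g (p z) = p (g' z)"
    using translation_lift[OF g] by blast
  obtain x where "x \<in> carrier X" "y = p x" using \<open>y \<in> carrier Y\<close> surj by blast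
  then show "f (g y) = g (f y)"
    using f' g' comm by (simp add: translation_in_carrier translations_commute_def)
qed

lemma translation_push:
  assumes "f \<in> translation_maps X"
  obtains g where "g \<in> translation_maps Y" "\<And>z. z \<in> carrier X \<Longrightarrow> g (p z) = p (f z)"
proof -
  obtain x where x: "x \<in> carrier X" "f = sigma X x \<or> f = delta X x"
    using assms by (auto simp: translation_maps_def)
  have pz: "p z \<in> carrier Y" if "z \<in> carrier X" for z using that surj by blast
  from x(2) show thesis
  proof
    assume "f = sigma X x"
    then show thesis
      using x pz by (intro that[OF sigma_in_translation_maps[OF pz[OF x(1)]]])
        (simp add: sigma_def hom_dot)
  next
    assume "f = delta X x"
    then show thesis
      using x pz by (intro that[OF delta_in_translation_maps[OF pz[OF x(1)]]])
        (simp add: delta_def hom_colon)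
  qed
qed

lemma no_invariant_subset_image:
  assumes min: "no_invariant_subset X"
  shows "no_invariant_subset Y"
  unfolding no_invariant_subset_def
proof (intro allI impI)
  fix S assume S: "S \<subseteq> carrier Y" "S \<noteq> {}" and inv: "\<forall>g \<in> translation_maps Y. g ` S \<subseteq> S"
  let ?R = "{x \<in> carrier X. p x \<in> S}"
  have R_inv: "f x \<in> ?R" if f: "f \<in> translation_maps X" and x: "x \<in> ?R" for f x
  proof -
    obtain g where "g \<in> translation_maps Y" "g (p x) = p (f x)"
      using translation_push[OF f] x by blast
    then show ?thesis using inv f x translation_in_carrier by fastforce
  qed
  have image_R: "p ` ?R = S" using S(1) unfolding surj[symmetric] by auto
  have "?R = carrier X"
  proof (rule min[unfolded no_invariant_subset_def, rule_format])
    show "?R \<noteq> {}" using S(2) image_R by (metis image_empty)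
    show "f ` ?R \<subseteq> ?R" if "f \<in> translation_maps X" for f
      using R_inv[OF that] by (rule image_subsetI)
  qed (rule Collect_restrict)
  then show "S = carrier Y" using image_R surj by simp
qed

end

definition Ret_proj :: "'a qcs \<Rightarrow> 'a \<Rightarrow> 'a"
  where "Ret_proj X x = class_rep (retract_rel X `` {x})"

lemma carrier_retract: "carrier (retract X) = (\<lambda>x. retract_rel X `` {x}) ` carrier X"
  by (auto simp: retract_def quotient_def)

lemma carrier_Ret: "carrier (Ret X) = Ret_proj X ` carrier X"
  by (auto simp: Ret_def transport_def carrier_retract Ret_proj_def)

lemma Ret_proj_hom:
  assumes "regular_q_cycle_set X" "x \<in> carrier X" "y \<in> carrier X"
  shows "Ret_proj X (x \<cdot>\<^bsub>X\<^esub> y) = Ret_proj X x \<cdot>\<^bsub>Ret X\<^esub> Ret_proj X y"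
    and "Ret_proj X (x \<Colon>\<^bsub>X\<^esub> y) = Ret_proj X x \<Colon>\<^bsub>Ret X\<^esub> Ret_proj X y"
proof -
  have "inv_into (carrier (retract X)) class_rep (Ret_proj X z) = retract_rel X `` {z}"
    if "z \<in> carrier X" for z
    using that inj_on_class_rep by (auto simp: Ret_proj_def carrier_retract intro!: inv_into_f_f)
  then show "Ret_proj X (x \<cdot>\<^bsub>X\<^esub> y) = Ret_proj X x \<cdot>\<^bsub>Ret X\<^esub> Ret_proj X y"
    and "Ret_proj X (x \<Colon>\<^bsub>X\<^esub> y) = Ret_proj X x \<Colon>\<^bsub>Ret X\<^esub> Ret_proj X y"
    using assms regular_q_cycle_set.retract_ops[OF assms]
    by (simp_all add: Ret_def transport_def) (simp_all add: Ret_proj_def)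
qed

lemma card_Ret_less:
  assumes fin: "finite (carrier X)" and ret: "retractable X" and "card (carrier X) \<noteq> 1"
  shows "card (carrier (Ret X)) < card (carrier X)"
proof -
  obtain x y where xy: "x \<in> carrier X" "y \<in> carrier X" "x \<noteq> y" "(x, y) \<in> retract_rel X"
    using ret assms(3) by (auto simp: retractable_def retract_rel_def)
  then have "Ret_proj X x = Ret_proj X y"
    using equiv_class_eq[OF equiv_retract_rel] by (metis Ret_proj_def)
  then have "\<not> inj_on (Ret_proj X) (carrier X)"
    using xy by (auto simp: inj_on_def)
  then show ?thesis
    using fin by (metis card_image_le carrier_Ret eq_card_imp_inj_on le_neq_implies_less)
qed

lemma multipermutational_if_commute:
  assumes "regular_q_cycle_set X" "finite (carrier X)"
    "translations_commute X" "no_invariant_subset X"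
  shows "multipermutational X"
  using assms
proof (induction "card (carrier X)" arbitrary: X rule: less_induct)
  case less
  note X = less.prems
  show ?case
  proof (cases "card (carrier X) = 1")
    case True
    then show ?thesis unfolding multipermutational_def by (intro exI[of _ 0]) simp
  next
    case False
    have "retractable X"
      using X regular_q_cycle_set.retractable_if_translations_free
        regular_q_cycle_set.translations_free_if_commute by blast
    then have "card (carrier (Ret X)) < card (carrier X)"
      using X False by (intro card_Ret_less)
    moreover have "translations_commute (Ret X)" "no_invariant_subset (Ret X)"
      using X translations_commute_image[of "Ret_proj X" X "Ret X"]
        no_invariant_subset_image[of "Ret_proj X" X "Ret X"]
      by (simp_all add: carrier_Ret Ret_proj_hom)
    ultimately have "multipermutational (Ret X)"
      using X by (intro less.hyps Ret_regular) (simp_all add: carrier_Ret)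
    then obtain n where "card (carrier ((Ret ^^ n) (Ret X))) = 1"
      by (auto simp: multipermutational_def)
    then have "card (carrier ((Ret ^^ Suc n) X)) = 1"
      by (simp add: funpow_swap1)
    then show ?thesis unfolding multipermutational_def by blast
  qed
qed


section \<open>From the permutation group to the translations\<close>

lemma (in regular_q_cycle_set) carrier_perm_group:
  "carrier (perm_group X) = generate (BijGroup (carrier X)) (translation_maps X)"
  using perm_group_generators
  by (simp add: perm_group_def carrier_subgroup_generated translation_maps_def Int_absorb1)

lemma (in regular_q_cycle_set) translations_in_perm_group:
  "translation_maps X \<subseteq> carrier (perm_group X)"
  by (auto simp: carrier_perm_group intro: generate.incl)

lemma (in regular_q_cycle_set) translations_free_if_acts_regularly:
  assumes "acts_regularly (perm_group X) (carrier X) (\<lambda>g. g)"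
  shows "translations_free X"
  unfolding translations_free_def
proof (intro ballI impI)
  fix f g z
  let ?G = "perm_group X"
  let ?T = "insert (\<lambda>x \<in> carrier X. x) (translation_maps X)"
  assume fg: "f \<in> ?T" "g \<in> ?T" and z: "z \<in> carrier X" and eq: "f z = g z"
  interpret act: transitive_action ?G "carrier X" "\<lambda>g. g"
    using assms by (simp add: acts_regularly_def)
  interpret G: group ?G
    using act.group_hom by (simp add: group_hom_def)
  have "?T \<subseteq> carrier ?G"
    using translations_in_perm_group G.one_closed
    by (simp add: perm_group_def BijGroup_def)
  then have f: "f \<in> carrier ?G" and g: "g \<in> carrier ?G" using fg by auto
  have "(inv\<^bsub>?G\<^esub> g \<otimes>\<^bsub>?G\<^esub> f) z = (inv\<^bsub>?G\<^esub> g) (g z)"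
    using f g z eq by (simp add: act.composition_rule)
  also have "\<dots> = z" using act.orbit_sym_aux[OF g z] by simp
  finally have "inv\<^bsub>?G\<^esub> g \<otimes>\<^bsub>?G\<^esub> f \<in> stabilizer ?G (\<lambda>g. g) z"
    using f g by (simp add: stabilizer_def)
  then have "inv\<^bsub>?G\<^esub> g \<otimes>\<^bsub>?G\<^esub> f = \<one>\<^bsub>?G\<^esub>"
    using assms z by (auto simp: acts_regularly_def)
  then show "f = g" using f g by (metis G.inv_equality G.inv_inv G.inv_closed G.inv_comm)
qed

text \<open>Finiteness enters because an injective map that sends a finite set into itself maps it onto
  itself; so a set invariant under the generators is invariant under their inverses.\<close>

lemma (in regular_q_cycle_set) no_invariant_subset_if_transitive:
  assumes fin: "finite (carrier X)"
    and trans: "transitive_action (perm_group X) (carrier X) (\<lambda>g. g)"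
  shows "no_invariant_subset X"
  unfolding no_invariant_subset_def
proof (intro allI impI)
  fix S assume S: "S \<subseteq> carrier X" "S \<noteq> {}" and inv: "\<forall>f \<in> translation_maps X. f ` S \<subseteq> S"
  have "h ` S \<subseteq> S" if "h \<in> generate (BijGroup (carrier X)) (translation_maps X)" for h
    using that
  proof induction
    case one
    then show ?case using S by (auto simp: BijGroup_def)
  next
    case (incl h)
    then show ?case using inv by blast
  next
    case (inv h)
    have bij: "bij_betw h (carrier X) (carrier X)" using inv by (rule translations_bij)
    have h: "h \<in> Bij (carrier X)"
      using perm_group_generators inv by (auto simp: translation_maps_def BijGroup_def)
    have "inj_on h S" using bij S by (meson bij_betw_def inj_on_subset)
    then have "h ` S = S"
      using inv \<open>\<forall>f \<in> translation_maps X. f ` S \<subseteq> S\<close> fin S by (meson endo_inj_surj finite_subset)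
    show ?case
    proof (rule image_subsetI)
      fix y assume "y \<in> S"
      then obtain z where z: "z \<in> S" "y = h z" using \<open>h ` S = S\<close> by blast
      then have "inv_into (carrier X) h y = z"
        using S bij by (auto simp: bij_betw_def intro: inv_into_f_f)
      then show "(inv\<^bsub>BijGroup (carrier X)\<^esub> h) y \<in> S"
        using z S \<open>y \<in> S\<close> by (auto simp: inv_BijGroup[OF h])
    qed
  next
    case (eng h1 h2)
    have sub: "generate (BijGroup (carrier X)) (translation_maps X) \<subseteq> carrier (BijGroup (carrier X))"
      using perm_group_generators
      by (intro group.generate_incl group_BijGroup) (simp add: translation_maps_def)
    then have "h1 \<in> Bij (carrier X)" "h2 \<in> Bij (carrier X)"
      using eng by (auto simp: BijGroup_def)
    then show ?case using eng.IH S by (auto simp: BijGroup_def compose_def)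
  qed
  then have stable: "h ` S \<subseteq> S" if "h \<in> carrier (perm_group X)" for h
    using that by (simp add: carrier_perm_group)
  obtain s where s: "s \<in> S" using S by blast
  have "y \<in> S" if y: "y \<in> carrier X" for y
  proof -
    obtain h where "h \<in> carrier (perm_group X)" "h s = y"
      using transitive_action.unique_orbit[OF trans, of s y] s S y by blast
    then show ?thesis using stable s by blast
  qed
  then show "S = carrier X" using S by blast
qed

lemma (in regular_q_cycle_set) translations_commute_if_comm_group:
  assumes "group_action (perm_group X) (carrier X) (\<lambda>g. g)" and comm: "comm_group (perm_group X)"
  shows "translations_commute X"
  unfolding translations_commute_def
proof (intro ballI)
  fix f g z assume "f \<in> translation_maps X" "g \<in> translation_maps X" and z: "z \<in> carrier X"
  then have f: "f \<in> carrier (perm_group X)" and g: "g \<in> carrier (perm_group X)"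
    using translations_in_perm_group by auto
  interpret group_action "perm_group X" "carrier X" "\<lambda>g. g" by fact
  have "f (g z) = (f \<otimes>\<^bsub>perm_group X\<^esub> g) z" using composition_rule[OF z f g] by simp
  also have "\<dots> = (g \<otimes>\<^bsub>perm_group X\<^esub> f) z"
    using comm f g by (simp add: comm_group_def comm_monoid.m_comm)
  also have "\<dots> = g (f z)" using composition_rule[OF z g f] by simp
  finally show "f (g z) = g (f z)" .
qed


theorem theorem1p8:
  fixes X :: "'a qcs"
  assumes "finite (carrier X)"
    and "indecomposable X"
    and "card (carrier X) > 1"
    and "acts_regularly (perm_group X) (carrier X) (\<lambda>g. g)"
  shows "retractable X \<and> (comm_group (perm_group X) \<longrightarrow> multipermutational X)"
proof (intro conjI impI)
  have trans: "transitive_action (perm_group X) (carrier X) (\<lambda>g. g)"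
    using assms(2) by (simp add: indecomposable_def)
  interpret regular_q_cycle_set X using assms(2) by (simp add: indecomposable_def)
  show "retractable X"
    using assms(1,4) by (intro retractable_if_translations_free translations_free_if_acts_regularly)
  show "multipermutational X" if "comm_group (perm_group X)"
  proof (rule multipermutational_if_commute)
    show "regular_q_cycle_set X" by unfold_locales
    show "translations_commute X"
      using trans that by (intro translations_commute_if_comm_group transitive_action.axioms(1))
    show "no_invariant_subset X"
      using assms(1) trans by (rule no_invariant_subset_if_transitive)
  qed (fact assms(1))
qed

end
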